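(* If a multiplicative function $f : \mathbb{N} \to \mathbb{C}$ satisfies \[ f(a^3 + b^3) = f(a^3) + f(b^3) \] for all $a, b \in \mathbb{N}$, then $f(n) = n$ for every $n \in \mathbb{N}$ except possibly those $n$ with $3 \mid n$ and $3^2 \nmid n$. Moreover, the value $f(3)$ can be set arbitrarily: for every $c \in \mathbb{C}$ there is a multiplicative function $f : \mathbb{N} \to \mathbb{C}$ with $f(3) = c$ satisfying $f(a^3+b^3) = f(a^3) + f(b^3)$ for all $a, b \in \mathbb{N}$.
   Context: $\mathbb{N}$ denotes the set of positive integers. A function $f : \mathbb{N} \to \mathbb{C}$ is multiplicative if $f(1) = 1$ and $f(mn) = f(m) f(n)$ whenever $\gcd(m,n) = 1$. *)

theory Defs
  imports Complex_Main
begin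

(* An arithmetic function on the positive integers is represented by a function on nat.
   All conditions are restricted to positive arguments, so the value at 0 is irrelevant. *)
definition multiplicative :: "(nat \<Rightarrow> complex) \<Rightarrow> bool" where
  "multiplicative f \<longleftrightarrow>
     f 1 = 1 \<and> (\<forall>m>0. \<forall>n>0. coprime m n \<longrightarrow> f (m * n) = f m * f n)"

definition additive_on_cubes :: "(nat \<Rightarrow> complex) \<Rightarrow> bool" where
  "additive_on_cubes f \<longleftrightarrow> (\<forall>a>0. \<forall>b>0. f (a ^ 3 + b ^ 3) = f (a ^ 3) + f (b ^ 3))"

end

theory Submission
  imports Defs "HOL-Computational_Algebra.Primes"
begin

text \<open>The values at \<open>4\<close>, \<open>8\<close> and \<open>27\<close> follow by elimination from coincidences among small sums of
  two cubes. Scaling \<open>1\<^sup>3 + 12\<^sup>3 = 9\<^sup>3 + 10\<^sup>3\<close> by \<open>2\<^sup>k\<close> and \<open>3\<^sup>k\<close> gives linear recursions for the values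
  at the cubes of powers of \<open>2\<close> and \<open>3\<close>. The rest is a simultaneous induction on \<open>f m = m\<close> and
  \<open>f (m\<^sup>3) = m\<^sup>3\<close>: one writes a multiple of \<open>m\<close>, respectively \<open>m\<^sup>3 + 1\<close> or \<open>m\<^sup>3 + 8\<close>, as
  \<open>(a + b) (a\<^sup>2 - a b + b\<^sup>2)\<close>. A number \<open>q\<close> primitively represented by the quadratic form, with
  \<open>3 q < m\<^sup>2\<close>, also divides a sum \<open>c\<^sup>3 + d\<^sup>3 = (c + d) q\<close> with \<open>c + d < m\<close>, so \<open>f q = q\<close> by induction.
  The value at \<open>3\<close> is free because sums of two cubes are never \<open>3\<close> or \<open>6\<close> modulo \<open>9\<close>.\<close>

section \<open>Divisibility tools and reduction of the quadratic form\<close>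

lemma power_part_decomposition:
  fixes p n :: nat
  assumes "p > 1" "n > 0"
  obtains k u where "n = p ^ k * u" "\<not> p dvd u" "u > 0"
proof -
  have "\<exists>k u. n = p ^ k * u \<and> \<not> p dvd u"
    using assms(2)
  proof (induction n rule: less_induct)
    case (less n)
    show ?case
    proof (cases "p dvd n")
      case True
      then obtain v where v: "n = p * v" by blast
      with less.prems assms(1) have "v < n" "v > 0" by auto
      from less.IH[OF this] obtain k u where "v = p ^ k * u" "\<not> p dvd u" by blast
      with v have "n = p ^ Suc k * u \<and> \<not> p dvd u" by simp
      then show ?thesis by blast
    next
      case False
      then have "n = p ^ 0 * n \<and> \<not> p dvd n" by simp
      then show ?thesis by blast
    qed
  qed
  with assms(2) that show thesis by (metis dvd_0_right gr0I)
qed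

text \<open>A common divisor of \<open>m\<close> and \<open>n\<close> divides
  \<open>r * n - s * m\<close>, which is \<open>k\<close>. Coprimality of polynomial expressions is
  thus certified by exhibiting multipliers \<open>r\<close> and \<open>s\<close>.\<close>

lemma coprime_if_linear_combination:
  fixes m :: nat
  assumes "coprime m k" "r * n = s * m + k"
  shows "coprime m n"
proof (rule coprimeI)
  fix c assume "c dvd m" "c dvd n"
  then have "c dvd s * m + k" using assms(2) by (metis dvd_mult)
  then have "c dvd k" using \<open>c dvd m\<close> by (simp add: dvd_add_right_iff)
  with \<open>c dvd m\<close> assms(1) show "is_unit c" by (auto dest: coprime_common_divisor)
qed

lemma coprime_3_iff: "coprime (3::nat) n \<longleftrightarrow> \<not> 3 dvd n" "coprime n 3 \<longleftrightarrow> \<not> 3 dvd n"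
proof -
  have "prime (3::nat)" by simp
  then show "coprime (3::nat) n \<longleftrightarrow> \<not> 3 dvd n"
    by (metis coprime_absorb_left not_prime_unit prime_imp_coprime)
  then show "coprime n 3 \<longleftrightarrow> \<not> 3 dvd n" by (simp add: coprime_commute)
qed

text \<open>The form \<open>c\<^sup>2 - c d + d\<^sup>2\<close> is invariant under \<open>(c, d) \<mapsto> (c, c - d)\<close>.\<close>

lemma eisenstein_form_reduced:
  fixes a b q :: nat
  assumes "coprime a b" "q + a * b = a\<^sup>2 + b\<^sup>2"
  obtains c d where "coprime c d" "q + c * d = c\<^sup>2 + d\<^sup>2" "2 * d \<le> c"
proof -
  have *: "\<exists>c d. coprime c d \<and> q + c * d = c\<^sup>2 + d\<^sup>2 \<and> 2 * d \<le> c"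
    if "coprime a b" "q + a * b = a\<^sup>2 + b\<^sup>2" "b \<le> a" for a b :: nat
  proof (cases "2 * b \<le> a")
    case False
    obtain e where e: "a = b + e" using \<open>b \<le> a\<close> le_Suc_ex by blast
    have "coprime a e" using that(1) unfolding e
      by (metis coprime_iff_gcd_eq_1 gcd.commute gcd_add1 gcd_add2)
    moreover have "q + a * e = a\<^sup>2 + e\<^sup>2"
      using that(2) unfolding e by (simp add: power2_eq_square algebra_simps)
    ultimately show ?thesis using False e by (intro exI[of _ a] exI[of _ e]) auto
  qed (use that in blast)
  show thesis
    using *[of a b] *[of b a] assms that
    by (metis add.commute coprime_commute mult.commute nat_le_linear)
qed

section \<open>Values at 4, 8 and 27\<close>

locale cube_additive =
  fixes f :: "nat \<Rightarrow> complex"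
  assumes multiplicative: "multiplicative f"
    and additive: "additive_on_cubes f"
begin

lemma one [simp]: "f 1 = 1" "f (Suc 0) = 1"
  using multiplicative by (auto simp: multiplicative_def)

lemma mult: "m > 0 \<Longrightarrow> n > 0 \<Longrightarrow> coprime m n \<Longrightarrow> f (m * n) = f m * f n"
  using multiplicative by (auto simp: multiplicative_def)

lemma cubes: "a > 0 \<Longrightarrow> b > 0 \<Longrightarrow> f (a ^ 3 + b ^ 3) = f (a ^ 3) + f (b ^ 3)"
  using additive by (auto simp: additive_on_cubes_def)

lemma cube_mult: "m > 0 \<Longrightarrow> n > 0 \<Longrightarrow> coprime m n \<Longrightarrow> f ((m * n) ^ 3) = f (m ^ 3) * f (n ^ 3)"
  by (simp add: power_mult_distrib mult)

lemma two: "f 2 = 2"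
  using cubes[of 1 1] by (simp add: numeral_2_eq_2)

lemma small_values: "f 4 = 4 \<and> f 8 = 8 \<and> f 27 = 27"
proof -
  have co: "coprime (4::nat) 7" "coprime (5::nat) 7" "coprime (5::nat) 13" "coprime (7::nat) 13"
    "coprime (7::nat) 19" "coprime (8::nat) 19" "coprime (8::nat) 9" "coprime (27::nat) 7"
    "coprime (2::nat) 7" "coprime (14::nat) 9" "coprime (91::nat) 19" "coprime (27::nat) 64"
    "coprime (8::nat) 125" "coprime (27::nat) 13" "coprime (4::nat) 9" "coprime (36::nat) 13"
    "coprime (27::nat) 19" "coprime (9::nat) 5" "coprime (45::nat) 19" "coprime (13::nat) 61"
    "coprime (8::nat) 343" "coprime (45::nat) 61"
    by (simp_all add: coprime_iff_gcd_eq_1 gcd_non_0_nat)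
  define x y z p a q r s w u v h where
    defs: "x = f 8" "y = f 27" "z = f 125" "p = f 7" "a = f 4" "q = f 5" "r = f 13" "s = f 19"
      "w = f 343" "u = f 512" "v = f 729" "h = f 61"
  have f9: "f 9 = 1 + x" using cubes[of 1 2] by (simp add: defs)
  have f64: "f 64 = x\<^sup>2"
    using cubes[of 2 4] mult[of 8 9] co f9 by (simp add: defs power2_eq_square algebra_simps)
  have f1728: "f 1728 = y * x\<^sup>2" using mult[of 27 64] co f64 by (simp add: defs)
  have f1000: "f 1000 = x * z" using mult[of 8 125] co by (simp add: defs)
  have f2744: "f 2744 = x * w" using mult[of 8 343] co by (simp add: defs)
  have e28: "a * p = 1 + y" using cubes[of 1 3] mult[of 4 7] co by (simp add: defs)
  have e35: "q * p = x + y" using cubes[of 2 3] mult[of 5 7] co by (simp add: defs)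
  have e65: "q * r = 1 + x\<^sup>2" using cubes[of 1 4] mult[of 5 13] co f64 by (simp add: defs)
  have e91: "p * r = y + x\<^sup>2" using cubes[of 3 4] mult[of 7 13] co f64 by (simp add: defs)
  have e133: "p * s = x + z" using cubes[of 2 5] mult[of 7 19] co by (simp add: defs)
  have e152: "x * s = y + z" using cubes[of 3 5] mult[of 8 19] co by (simp add: defs)
  have e189: "y * p = x\<^sup>2 + z" using cubes[of 4 5] mult[of 27 7] co f64 by (simp add: defs)
  have e126: "2 * p * (1 + x) = 1 + z"
    using cubes[of 1 5] mult[of 14 9] mult[of 2 7] co f9 two by (simp add: defs)
  have e1729: "p * r * s = 1 + y * x\<^sup>2"
    using cubes[of 1 12] mult[of 91 19] mult[of 7 13] co f1728 by (simp add: defs)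
  have e1729': "1 + y * x\<^sup>2 = v + x * z"
    using cubes[of 9 10] cubes[of 1 12] f1728 f1000 by (simp add: defs)
  have e351: "y * r = x + w" using cubes[of 2 7] mult[of 27 13] co by (simp add: defs)
  have e468: "a * (1 + x) * r = z + w"
    using cubes[of 5 7] mult[of 36 13] mult[of 4 9] co f9 by (simp add: defs)
  have e513: "y * s = 1 + u" using cubes[of 1 8] mult[of 27 19] co by (simp add: defs)
  have e855: "(1 + x) * q * s = w + u"
    using cubes[of 7 8] mult[of 45 19] mult[of 9 5] co f9 by (simp add: defs)
  have e793: "r * h = x\<^sup>2 + v" using cubes[of 4 9] mult[of 13 61] co f64 by (simp add: defs)
  have e2745: "(1 + x) * q * h = 1 + x * w"
    using cubes[of 1 14] mult[of 45 61] mult[of 9 5] co f9 f2744 by (simp add: defs)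
  \<comment> \<open>Eliminating \<open>a\<close>, \<open>q\<close>, \<open>r\<close>,
    \<open>s\<close>, \<open>w\<close> leaves three relations in \<open>p\<close>, \<open>x\<close>,
    \<open>y\<close>, \<open>z\<close>. For instance, \<open>E3\<close> is
    \<open>p * p * (q * r) = (q * p) * (p * r)\<close>, and \<open>E4\<close> removes
    \<open>w\<close> from \<open>e351\<close> and \<open>e468\<close>. Nothing is divided by
    \<open>p\<close>, which may still vanish.\<close>
  have E3: "p\<^sup>2 * (1 + x\<^sup>2) = (x + y) * (y + x\<^sup>2)" using e35 e65 e91 by algebra
  have E4: "(y + x\<^sup>2) * (p * y - (1 + y) * (1 + x)) = p\<^sup>2 * (x - z)"
    using e351 e468 e28 e91 by algebra
  have E5: "p\<^sup>2 * (1 + y * x\<^sup>2) = (y + x\<^sup>2) * (x + z) * p" using e1729 e91 e133 by algebra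
  have z: "z = y * p - x\<^sup>2" using e189 by simp
  \<comment> \<open>Evaluate \<open>p * x * s\<close> in two ways:
    \<open>x * (x + z) = p * (y + z)\<close>, where \<open>p * y = x^2 + z\<close>.\<close>
  have "z * (1 + p - x) = 0" using e133 e152 e189 by algebra
  moreover have False if "z = 0"
  proof -
    \<comment> \<open>If \<open>z = 0\<close>, then \<open>p\<close> and \<open>y\<close> are
      rational functions of \<open>x\<close>. \<open>E5\<close> becomes \<open>C = 0\<close>, and
      \<open>E3\<close> combined with \<open>E4\<close> becomes \<open>A = 0\<close>.\<close>
    define A C where "A = 2*x^6 + 4*x^5 + 5*x^4 + 7*x^3 + 3*x\<^sup>2 + x + 1"
      and "C = 2*x^5 + 8*x^4 + 6*x^3 - 1"
    have p: "2 * p * (1 + x) = 1" and y: "y * p = x\<^sup>2" using that e126 e189 by auto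
    then have "p \<noteq> 0" "1 + x \<noteq> 0" by auto
    have E3': "p^4 * (1 + x\<^sup>2) = x^3 * (p + x) * (1 + p)"
      using E3 y by algebra
    have "x * (x * (1 + p) * (p * x\<^sup>2 - (p + x\<^sup>2) * (1 + x)) - p^4) = 0"
      using E4 y that by algebra
    moreover have "x \<noteq> 0" using E3' \<open>p \<noteq> 0\<close> by auto
    ultimately have E4': "x * (1 + p) * (p * x\<^sup>2 - (p + x\<^sup>2) * (1 + x)) = p^4" by simp
    have E5': "p\<^sup>2 + p * x^4 = x^3 * (1 + p)"
    proof -
      have "p * (p\<^sup>2 + p * x^4) = p * (x^3 * (1 + p))" using E5 y that by algebra
      with \<open>p \<noteq> 0\<close> show ?thesis by simp
    qed
    have "C = 0" using E5' p unfolding C_def by algebra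
    moreover have "A = 0"
    proof -
      have "p \<noteq> - 1" using E4' \<open>p \<noteq> 0\<close> by auto
      have "x * (1 + p) * (x\<^sup>2 * (p + x) - (1 + x\<^sup>2) * (p * x\<^sup>2 - (p + x\<^sup>2) * (1 + x))) = 0"
        using E3' E4' by algebra
      then have "x\<^sup>2 * (p + x) = (1 + x\<^sup>2) * (p * x\<^sup>2 - (p + x\<^sup>2) * (1 + x))"
        using \<open>x \<noteq> 0\<close> \<open>p \<noteq> - 1\<close> by (auto simp: add_eq_0_iff)
      with p show ?thesis unfolding A_def by algebra
    qed
    \<comment> \<open>a Bezout identity for the coprime polynomials \<open>A\<close> and \<open>C\<close>\<close>
    moreover have "(1052*x^4 + 29624*x^3 + 81148*x\<^sup>2 - 6066*x - 35778) * A
        - (1052*x^5 + 27520*x^4 + 29790*x^3 + 32252*x\<^sup>2 + 41844*x - 21347) * C = -57125"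
      unfolding A_def C_def by algebra
    ultimately show False by simp
  qed
  ultimately have "1 + p - x = 0" by auto
  then have p: "p = x - 1" by algebra
  have z': "z = 2 * x\<^sup>2 - 3" using e126 p by algebra
  \<comment> \<open>Equating \<open>y * (x - 1) - x^2\<close> with \<open>2 * x^2 - 3\<close> gives
    \<open>y * (x - 1) = 3 * (x^2 - 1)\<close>.\<close>
  have "(x - 1) * (y - (3 * x + 3)) = 0" using z z' p by algebra
  \<comment> \<open>the shadow of a function depending only on \<open>n mod 7\<close>, with values \<open>0\<close>, \<open>1\<close>, \<open>-1\<close> at cubes\<close>
  moreover have False if "x = 1"
  proof -
    have "p = 0" "z = -1" using that p z' by auto
    have "y = -1" using e28 \<open>p = 0\<close> by (simp add: eq_neg_iff_add_eq_0 add.commute)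
    have "s = -2" using e152 that \<open>y = -1\<close> \<open>z = -1\<close> by simp
    have "v = 1" using e1729' that \<open>y = -1\<close> \<open>z = -1\<close> by simp
    have "u = 1" using e513 \<open>s = -2\<close> \<open>y = -1\<close> by simp
    have "w = - r - 1" using e351 that \<open>y = -1\<close> by algebra
    have "r = 4 * q" using e855 that \<open>s = -2\<close> \<open>u = 1\<close> \<open>w = - r - 1\<close> by algebra
    have "q * r = 2" using e65 that by simp
    have "r * h = 2" using e793 that \<open>v = 1\<close> by simp
    have "2 * q * h = - r" using e2745 that \<open>w = - r - 1\<close> by algebra
    \<comment> \<open>Since \<open>r\<close> is nonzero, \<open>h = q\<close>, so
      \<open>2 * q^2 = - r\<close>. But \<open>r = 4 * q\<close> and \<open>q * r = 2\<close> give
      \<open>2 * q^2 = 1\<close>, hence \<open>r = -1\<close> and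
      \<open>q * r = 1/4\<close>.\<close>
    then have "(1::complex) = 0"
      using \<open>r * h = 2\<close> \<open>q * r = 2\<close> \<open>r = 4 * q\<close> by algebra
    then show False by simp
  qed
  ultimately have y: "y = 3 * x + 3" by auto
  \<comment> \<open>Only \<open>x\<close> is left. The polynomials from \<open>E3\<close> and
    \<open>E4\<close> share the factor \<open>x - 8\<close>, and their cofactors have no common
    root.\<close>
  have C1: "(x - 8) * (x^3 + 2 * x\<^sup>2 + 3 * x + 1) = 0" using E3 p y by algebra
  have C2: "(x + 1) * (x - 8) * (2 * x\<^sup>2 + 2 * x + 3) = 0" using E4 p y z' by algebra
  have "x = 8"
  proof (rule ccontr)
    assume "x \<noteq> 8"
    with C1 have 1: "x^3 + 2 * x\<^sup>2 + 3 * x + 1 = 0" by simp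
    from C2 \<open>x \<noteq> 8\<close> have "x + 1 = 0 \<or> 2 * x\<^sup>2 + 2 * x + 3 = 0" by simp
    then show False
    proof
      assume "x + 1 = 0"
      with 1 have "(1::complex) = 0" by algebra
      then show False by simp
    next
      assume 2: "2 * x\<^sup>2 + 2 * x + 3 = 0"
      \<comment> \<open>Dividing the cubic by the quadratic leaves the remainder
        \<open>(x - 1) / 2\<close>.\<close>
      with 1 have "x = 1" by algebra
      with 2 show False by simp
    qed
  qed
  with y p have "y = 27" "p = 7" by auto
  with e28 have "a = 4" by auto
  with \<open>x = 8\<close> \<open>y = 27\<close> show ?thesis by (simp add: defs)
qed

section \<open>Cubes of powers of 2 and 3\<close>

lemma cube_power_2: "f ((2 ^ k) ^ 3) = of_nat ((2 ^ k) ^ 3)"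
  and cube_power_3: "f ((3 ^ k) ^ 3) = of_nat ((3 ^ k) ^ 3)"
proof -
  have co: "coprime (4::nat) 7" "coprime (2::nat) 7" "coprime (14::nat) 9"
      "coprime (8::nat) 9" "coprime (27::nat) 64" "coprime (8::nat) 125"
    by (simp_all add: coprime_iff_gcd_eq_1 gcd_non_0_nat)
  note sv = small_values
  have f7: "f 7 = 7" using cubes[of 1 3] mult[of 4 7] co sv by simp
  have f9: "f 9 = 9" using cubes[of 1 2] sv by simp
  have f64: "f 64 = 64" using cubes[of 2 4] mult[of 8 9] co f9 sv by simp
  have f125: "f 125 = 125"
    using cubes[of 1 5] mult[of 14 9] mult[of 2 7] co f9 two f7 by simp
  have f1000: "f 1000 = 1000" using mult[of 8 125] co f125 sv by simp
  have f729: "f 729 = 729"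
    using cubes[of 9 10] cubes[of 1 12] mult[of 27 64] co f64 f1000 sv by simp
  \<comment> \<open>For \<open>t = 2 ^ k\<close> the odd factors 729, 125 and 27 split off, relating
    the values at the cubes of \<open>t\<close>, \<open>2 * t\<close>, \<open>4 * t\<close>. For
    \<open>t = 3 ^ k\<close> the factors 1000 and 64 do the same for \<open>t\<close>,
    \<open>3 * t\<close>, \<open>9 * t\<close>. Both recursions have order two, so the inductions
    carry two consecutive exponents.\<close>
  have taxicab: "f (729 * t ^ 3) + f (1000 * t ^ 3) = f (t ^ 3) + f (1728 * t ^ 3)"
    if "t > 0" for t :: nat
    using cubes[of "9 * t" "10 * t"] cubes[of t "12 * t"] that by (simp add: power_mult_distrib)
  have "f ((2 ^ k) ^ 3) = of_nat ((2 ^ k) ^ 3) \<and>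
        f ((2 ^ Suc k) ^ 3) = of_nat ((2 ^ Suc k) ^ 3)" for k
  proof (induction k)
    case (Suc k)
    define t :: nat where "t = 2 ^ k"
    have odd: "coprime m (t ^ 3)" if "odd m" for m
      using that by (auto simp: t_def)
    have "t > 0" by (simp add: t_def)
    have "f (729 * t ^ 3) = 729 * f (t ^ 3)"
      using mult[of 729 "t ^ 3"] odd[of 729] \<open>t > 0\<close> f729 by simp
    moreover have "f (1000 * t ^ 3) = 125 * f ((2 * t) ^ 3)"
      using mult[of 125 "(2 * t) ^ 3"] odd[of 125] co(6) \<open>t > 0\<close> f125
      by (simp add: power_mult_distrib coprime_commute)
    moreover have "f (1728 * t ^ 3) = 27 * f ((4 * t) ^ 3)"
      using mult[of 27 "(4 * t) ^ 3"] odd[of 27] co(5) \<open>t > 0\<close> sv by (simp add: power_mult_distrib)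
    ultimately have "27 * f ((4 * t) ^ 3) = 27 * of_nat ((4 * t) ^ 3)"
      using taxicab[OF \<open>t > 0\<close>] Suc by (simp add: t_def power_mult_distrib)
    with Suc show ?case by (simp add: t_def)
  qed (use small_values in simp)
  then show "f ((2 ^ k) ^ 3) = of_nat ((2 ^ k) ^ 3)" by blast
  have "f ((3 ^ k) ^ 3) = of_nat ((3 ^ k) ^ 3) \<and>
        f ((3 ^ Suc k) ^ 3) = of_nat ((3 ^ Suc k) ^ 3)" for k
  proof (induction k)
    case (Suc k)
    define t :: nat where "t = 3 ^ k"
    have co3: "coprime m (t ^ 3)" if "\<not> 3 dvd m" for m
      using that by (simp add: t_def coprime_3_iff)
    have "t > 0" by (simp add: t_def)
    have "f (1000 * t ^ 3) = 1000 * f (t ^ 3)"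
      using mult[of 1000 "t ^ 3"] co3[of 1000] \<open>t > 0\<close> f1000 by simp
    moreover have "f (1728 * t ^ 3) = 64 * f ((3 * t) ^ 3)"
      using mult[of 64 "(3 * t) ^ 3"] co3[of 64] co \<open>t > 0\<close> f64
      by (simp add: power_mult_distrib coprime_commute)
    ultimately have "f ((9 * t) ^ 3) = of_nat ((9 * t) ^ 3)"
      using taxicab[OF \<open>t > 0\<close>] Suc by (simp add: t_def power_mult_distrib)
    with Suc show ?case by (simp add: t_def)
  qed (use small_values in simp)
  then show "f ((3 ^ k) ^ 3) = of_nat ((3 ^ k) ^ 3)" by blast
qed

section \<open>Values at factors of sums of two cubes\<close>

text \<open>The induction hypothesis. Its cube clause has no exception, since a cube divisible by 3
  is divisible by 27.\<close>

definition determined_below :: "nat \<Rightarrow> bool" where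
  "determined_below m \<longleftrightarrow> (\<forall>k. 0 < k \<longrightarrow> k < m \<longrightarrow>
     f (k ^ 3) = of_nat (k ^ 3) \<and> (\<not> (3 dvd k \<and> \<not> 9 dvd k) \<longrightarrow> f k = of_nat k))"

lemma determined_belowD:
  assumes "determined_below m" "0 < k" "k < m"
  shows "f (k ^ 3) = of_nat (k ^ 3)" "\<not> (3 dvd k \<and> \<not> 9 dvd k) \<Longrightarrow> f k = of_nat k"
  using assms by (auto simp: determined_below_def)

lemma value_cofactor:
  assumes "a > 0" "b > 0" "m * q = a ^ 3 + b ^ 3" "coprime m q"
    and "f (a ^ 3) = of_nat (a ^ 3)" "f (b ^ 3) = of_nat (b ^ 3)" "f q = of_nat q"
  shows "f m = of_nat m"
proof -
  have "m * q > 0" using assms(1,3) by simp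
  then have "m > 0" "q > 0" by auto
  have "f m * of_nat q = of_nat (m * q)"
    using mult[OF \<open>m > 0\<close> \<open>q > 0\<close> assms(4)] cubes[OF assms(1,2)] assms by simp
  with \<open>q > 0\<close> show ?thesis by simp
qed

text \<open>For a reduced representation \<open>(c + d)\<^sup>2 \<le> 3 q\<close>, so that \<open>(c + d) q = c\<^sup>3 + d\<^sup>3\<close>
  involves only arguments whose values are already determined.\<close>

lemma eisenstein_form_value:
  assumes "determined_below m" "coprime a b" "q + a * b = a\<^sup>2 + b\<^sup>2" "\<not> 3 dvd q" "3 * q < m\<^sup>2"
  shows "f q = of_nat q"
proof -
  obtain c d where cd: "coprime c d" "q + c * d = c\<^sup>2 + d\<^sup>2" "2 * d \<le> c"
    using eisenstein_form_reduced assms(2,3) by blast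
  show ?thesis
  proof (cases "d = 0")
    case True
    \<comment> \<open>Coprimality of \<open>c\<close> and 0 forces \<open>c = 1\<close>, so
      \<open>q = 1\<close>.\<close>
    with cd show ?thesis by simp
  next
    case False
    obtain g where g: "c = 2 * d + g" using cd(3) le_Suc_ex by blast
    have q: "q = 3 * d\<^sup>2 + 3 * d * g + g\<^sup>2"
      using cd(2) unfolding g by (simp add: power2_eq_square algebra_simps)
    \<comment> \<open>The difference of the two sides is \<open>3 * d * g + 2 * g^2\<close>.\<close>
    have "(c + d)\<^sup>2 \<le> 3 * q"
      unfolding g q by (simp add: power2_eq_square algebra_simps)
    then have "(c + d)\<^sup>2 < m\<^sup>2" using assms(5) by simp
    then have less: "c + d < m" by (rule power_less_imp_less_base) simp
    \<comment> \<open>Modulo 3 this shows that \<open>c + d\<close> is not an exceptional argument;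
      modulo a common divisor of \<open>c + d\<close> and \<open>q\<close> it gives their
      coprimality.\<close>
    have square: "q + 3 * (c * d) = (c + d) * (c + d)"
      using cd(2) by (simp add: power2_eq_square algebra_simps)
    have "\<not> 3 dvd c + d"
      using assms(4) square by (metis dvd_add_left_iff dvd_mult2 dvd_triv_left)
    have "coprime (c + d) (c * d)"
      using cd(1) unfolding coprime_mult_right_iff
      by (metis coprime_iff_gcd_eq_1 gcd.commute gcd_add1 gcd_add2)
    with \<open>\<not> 3 dvd c + d\<close> have co: "coprime (c + d) (3 * (c * d))"
      by (simp add: coprime_3_iff)
    have "coprime (c + d) q"
    proof (rule coprimeI)
      fix e assume "e dvd c + d" "e dvd q"
      then have "e dvd 3 * (c * d)" using square by (metis dvd_add_right_iff dvd_mult2)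
      with \<open>e dvd c + d\<close> show "is_unit e" by (rule coprime_common_divisor[OF co])
    qed
    moreover have "q * (c + d) = c ^ 3 + d ^ 3"
      unfolding q g by (simp add: power2_eq_square power3_eq_cube algebra_simps)
    moreover have "f (c + d) = of_nat (c + d)"
      using determined_belowD(2)[OF assms(1) _ less] False \<open>\<not> 3 dvd c + d\<close> by simp
    ultimately show ?thesis
      using determined_belowD(1)[OF assms(1)] False less cd(3)
      by (intro value_cofactor[of c d q "c + d"]) (auto simp: coprime_commute)
  qed
qed

text \<open>For \<open>a = 3 * j + 1\<close> and \<open>b = 3 * j + 2\<close> both
  \<open>a + b\<close> and \<open>a^2 - a b + b^2\<close> contain a factor 3, which together make
  the 9. Only \<open>b\<close> has to lie below \<open>m\<close>, so the argument itself may exceed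
  \<open>m\<close>; the steps for cubes rely on this.\<close>

lemma value_odd_9:
  assumes "determined_below m" "3 * j + 2 < m"
  shows "f (9 * (2 * j + 1)) = of_nat (9 * (2 * j + 1))"
proof (rule value_cofactor[of "3 * j + 1" "3 * j + 2" _ "3 * j\<^sup>2 + 3 * j + 1"])
  let ?q = "3 * j\<^sup>2 + 3 * j + 1"
  show "9 * (2 * j + 1) * ?q = (3 * j + 1) ^ 3 + (3 * j + 2) ^ 3"
    by (simp add: power2_eq_square power3_eq_cube algebra_simps)
  have "coprime 3 ?q"
    by (rule coprime_if_linear_combination[of _ 1 1 _ "j\<^sup>2 + j"]) auto
  moreover have "coprime (2 * j + 1) ?q"
    by (rule coprime_if_linear_combination[of _ 1 4 _ "3 * (2 * j + 1)"])
      (auto simp: power2_eq_square algebra_simps)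
  ultimately have "coprime (3 * 3 * (2 * j + 1)) ?q" by (simp only: coprime_mult_left_iff)
  then show "coprime (9 * (2 * j + 1)) ?q" by simp
  have "(3 * j + 3)\<^sup>2 \<le> m\<^sup>2" using assms(2) by (intro power_mono) auto
  then have "3 * ?q < m\<^sup>2" by (simp add: power2_eq_square algebra_simps)
  \<comment> \<open>If 3 divides \<open>a + b\<close>, a third of \<open>a^2 - a b + b^2\<close> is
    the form at \<open>(2 a - b) / 3\<close> and \<open>(a + b) / 3\<close>. Here the roles of
    \<open>a\<close> and \<open>b\<close> are exchanged.\<close>
  moreover have "coprime (j + 1) (2 * j + 1)"
    by (subst coprime_commute, rule coprime_if_linear_combination[of _ 1 2 _ 1]) auto
  moreover have "\<not> 3 dvd ?q" using \<open>coprime 3 ?q\<close> unfolding coprime_3_iff .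
  ultimately show "f ?q = of_nat ?q"
    by (intro eisenstein_form_value[OF assms(1), of "j + 1" "2 * j + 1"])
      (auto simp: power2_eq_square algebra_simps)
qed (use determined_belowD(1)[OF assms(1)] assms(2) in auto)

text \<open>Write \<open>m\<close> as a sum of consecutive numbers \<open>n\<close> and
  \<open>n + 1\<close>; the cofactor is \<open>n^2 + n + 1\<close>. The bound on it amounts to
  \<open>n^2 + n > 2\<close>, hence \<open>m \<ge> 5\<close>.\<close>

lemma value_odd:
  assumes "determined_below m" "odd m" "m \<ge> 5" "\<not> 3 dvd m"
  shows "f m = of_nat m"
proof -
  obtain n where m: "m = 2 * n + 1" using assms(2) by (elim oddE)
  let ?q = "n\<^sup>2 + n + 1"
  have "n \<ge> 2" using assms(3) m by simp
  have "coprime m 3" using assms(4) unfolding coprime_3_iff .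
  then have "coprime m ?q"
    by (rule coprime_if_linear_combination[of _ _ 4 _ m])
      (simp add: m power2_eq_square algebra_simps)
  moreover have "m * ?q = n ^ 3 + (n + 1) ^ 3"
    unfolding m by (simp add: power2_eq_square power3_eq_cube algebra_simps)
  moreover have "f ?q = of_nat ?q"
  proof (rule eisenstein_form_value[OF assms(1), of n "n + 1"])
    show "\<not> 3 dvd ?q"
    proof
      assume "3 dvd ?q"
      then have "3 dvd 4 * ?q" by (rule dvd_mult)
      moreover have "4 * ?q = m ^ 2 + 3" unfolding m by (simp add: power2_eq_square algebra_simps)
      ultimately have "3 dvd m ^ 2" by (metis dvd_add_left_iff dvd_refl)
      with assms(4) show False using prime_dvd_power[of 3 m 2] by simp
    qed
    have "2 * 2 \<le> n * n" using \<open>n \<ge> 2\<close> by (rule mult_le_mono) (use \<open>n \<ge> 2\<close> in simp)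
    then show "3 * ?q < m\<^sup>2" unfolding m by (simp add: power2_eq_square algebra_simps)
  qed (auto simp: power2_eq_square algebra_simps)
  ultimately show ?thesis
    using determined_belowD(1)[OF assms(1)] \<open>n \<ge> 2\<close> m
    by (intro value_cofactor[of n "n + 1" m ?q]) auto
qed

text \<open>Here \<open>4 * t\<close> is the sum of the coprime odd numbers \<open>2 * t - 1\<close>
  and \<open>2 * t + 1\<close>, with cofactor \<open>4 * t^2 + 3\<close>. The bound on the cofactor
  fails for \<open>t = 1\<close>, so the value at 4 has to come from
  \<open>small_values\<close>.\<close>

lemma value_4:
  assumes "determined_below (4 * t)" "t \<ge> 2" "\<not> 3 dvd t"
  shows "f (4 * t) = of_nat (4 * t)"
proof -
  obtain n where t: "t = n + 1" using assms(2) by (intro that[of "t - 1"]) simp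
  let ?q = "4 * t\<^sup>2 + 3"
  have "n \<ge> 1" using assms(2) t by simp
  have "\<not> 3 dvd 4 * t" using assms(3) prime_dvd_mult_iff[of 3 4 t] by simp
  then have "coprime (4 * t) 3" unfolding coprime_3_iff .
  then have "coprime (4 * t) ?q"
    by (rule coprime_if_linear_combination[of _ _ 1 _ t]) (simp add: power2_eq_square)
  moreover have "4 * t * ?q = (2 * n + 1) ^ 3 + (2 * n + 3) ^ 3"
    unfolding t by (simp add: power2_eq_square power3_eq_cube algebra_simps)
  moreover have "f ?q = of_nat ?q"
  proof (rule eisenstein_form_value[OF assms(1), of "2 * n + 1" "2 * n + 3"])
    show "coprime (2 * n + 1) (2 * n + 3)"
      by (rule coprime_if_linear_combination[of _ 2 1 _ 1]) auto
    show "\<not> 3 dvd ?q"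
      using assms(3) prime_dvd_mult_iff[of 3 4 "t\<^sup>2"] prime_dvd_power[of 3 t 2]
      by (auto simp: dvd_add_left_iff)
    have "2 * 2 \<le> t * t" using assms(2) by (intro mult_le_mono)
    then show "3 * ?q < (4 * t)\<^sup>2" by (simp add: power2_eq_square algebra_simps)
  qed (auto simp: t power2_eq_square algebra_simps)
  ultimately show ?thesis
    using determined_belowD(1)[OF assms(1)] \<open>n \<ge> 1\<close> t
    by (intro value_cofactor[of "2 * n + 1" "2 * n + 3" "4 * t" ?q]) auto
qed

section \<open>Cubes of numbers coprime to 6\<close>

lemma cube_value:
  assumes "b > 0" "m > 0" "m ^ 3 + b ^ 3 = n * q" "coprime n q"
    and "f n = of_nat n" "f q = of_nat q" "f (b ^ 3) = of_nat (b ^ 3)"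
  shows "f (m ^ 3) = of_nat (m ^ 3)"
proof -
  have "n * q > 0" using assms(1) unfolding assms(3)[symmetric] by simp
  then have "f (m ^ 3 + b ^ 3) = of_nat (m ^ 3 + b ^ 3)"
    using mult assms by simp
  with cubes[OF assms(2,1)] assms(7) show ?thesis by simp
qed

text \<open>Adding \<open>2 ^ 3\<close> makes the sum of the bases an odd multiple of 3, so the sum
  of cubes is an odd multiple of 9, covered by \<open>value_odd_9\<close>, times a value of the
  form.\<close>

lemma cube_1_mod_6:
  assumes "determined_below (6 * i + 7)"
  shows "f ((6 * i + 7) ^ 3) = of_nat ((6 * i + 7) ^ 3)"
proof (rule cube_value[of 2])
  let ?s = "2 * (i + 1) + 1" and ?q = "12 * i\<^sup>2 + 24 * i + 13"
  show "(6 * i + 7) ^ 3 + 2 ^ 3 = 9 * ?s * ?q"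
    by (simp add: power2_eq_square power3_eq_cube algebra_simps)
  have s4: "coprime ?s 4"
    using coprime_power_right_iff[of ?s 2 2] by simp
  have "coprime 3 ?q"
    by (rule coprime_if_linear_combination[of _ 1 1 _ "4 * i\<^sup>2 + 8 * i + 4"]) auto
  moreover have "coprime ?s ?q"
    using s4 by (rule coprime_if_linear_combination[of _ _ 1 _ "6 * i + 3"])
      (simp add: power2_eq_square algebra_simps)
  ultimately have "coprime (3 * 3 * ?s) ?q" by (simp only: coprime_mult_left_iff)
  then show "coprime (9 * ?s) ?q" by simp
  show "f (9 * ?s) = of_nat (9 * ?s)"
    using assms by (rule value_odd_9) simp
  show "f ?q = of_nat ?q"
  \<comment> \<open>With \<open>m = 6 * i + 7\<close> these are \<open>(2 * m - 2) / 3\<close> and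
    \<open>(m + 2) / 3\<close>, the division by 3 used in \<open>value_odd_9\<close>.\<close>
  proof (rule eisenstein_form_value[OF assms, of "4 * (i + 1)" ?s])
    have "coprime (i + 1) ?s"
      by (rule coprime_if_linear_combination[of _ 1 1 _ 2]) auto
    moreover have "coprime 4 ?s" using s4 by (rule coprime_commute[THEN iffD1])
    ultimately show "coprime (4 * (i + 1)) ?s" by (simp only: coprime_mult_left_iff)
    show "\<not> 3 dvd ?q" using \<open>coprime 3 ?q\<close> unfolding coprime_3_iff .
  qed (auto simp: power2_eq_square algebra_simps)
  show "f (2 ^ 3) = of_nat (2 ^ 3)" using small_values by simp
qed auto

text \<open>Here \<open>1 ^ 3\<close> is added and the sum of the bases is
  \<open>6 * (j + 1)\<close>, which is even. The power of 2 in \<open>9 * ?s\<close> is split off: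
  it lies below \<open>6 * j + 5\<close>, and \<open>value_odd_9\<close> handles the odd
  part.\<close>

lemma cube_5_mod_6:
  assumes "determined_below (6 * j + 5)"
  shows "f ((6 * j + 5) ^ 3) = of_nat ((6 * j + 5) ^ 3)"
proof (rule cube_value[of 1])
  let ?s = "2 * (j + 1)" and ?q = "12 * j\<^sup>2 + 18 * j + 7"
  show "(6 * j + 5) ^ 3 + 1 ^ 3 = 9 * ?s * ?q"
    by (simp add: power2_eq_square power3_eq_cube algebra_simps)
  have "coprime 3 ?q"
    by (rule coprime_if_linear_combination[of _ 1 1 _ "4 * j\<^sup>2 + 6 * j + 2"]) auto
  moreover have "coprime ?s ?q"
    by (rule coprime_if_linear_combination[of _ 1 1 _ "6 * j + 3"])
      (auto simp: power2_eq_square algebra_simps)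
  ultimately have "coprime (3 * 3 * ?s) ?q" by (simp only: coprime_mult_left_iff)
  then show "coprime (9 * ?s) ?q" by simp
  obtain k u where ku: "j + 1 = 2 ^ k * u" "odd u" "u > 0"
    using power_part_decomposition[of 2 "j + 1"] by auto
  obtain l where l: "u = 2 * l + 1" using ku(2) by (elim oddE)
  have "u \<le> j + 1" "2 ^ k \<le> j + 1" using ku by simp_all
  have "f (9 * u) = of_nat (9 * u)"
    unfolding l using \<open>u \<le> j + 1\<close> l by (intro value_odd_9[OF assms]) simp
  moreover have "f (2 ^ (k + 1)) = of_nat (2 ^ (k + 1))"
  proof -
    have "\<not> 3 dvd (2::nat) ^ (k + 1)" using prime_dvd_power[of "3::nat" 2 "k + 1"] by auto
    with \<open>2 ^ k \<le> j + 1\<close> show ?thesis by (intro determined_belowD(2)[OF assms]) auto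
  qed
  moreover have "9 * ?s = 2 ^ (k + 1) * (9 * u)" using ku(1) by simp
  moreover have "coprime (2 ^ (k + 1)) (9 * u)" using ku(2) by simp
  ultimately show "f (9 * ?s) = of_nat (9 * ?s)"
    using mult[of "2 ^ (k + 1)" "9 * u"] ku(3) by simp
  show "f ?q = of_nat ?q"
  proof (rule eisenstein_form_value[OF assms, of "4 * j + 3" ?s])
    show "coprime (4 * j + 3) ?s"
      by (rule coprime_if_linear_combination[of _ 1 2 _ 1]) auto
    show "\<not> 3 dvd ?q" using \<open>coprime 3 ?q\<close> unfolding coprime_3_iff .
  qed (auto simp: power2_eq_square algebra_simps)
qed auto

section \<open>The induction step\<close>

text \<open>An odd \<open>m\<close> falls under \<open>value_odd\<close> or
  \<open>value_odd_9\<close>, apart from 1, and a power of 2 under \<open>value_4\<close> or the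
  known values at 2 and 4. Any other \<open>m\<close> is a product of two smaller coprime factors,
  and its odd part is exceptional only if \<open>m\<close> is.\<close>

lemma value_step:
  assumes "determined_below m" "m > 0" "\<not> (3 dvd m \<and> \<not> 9 dvd m)"
  shows "f m = of_nat m"
proof -
  obtain k u where ku: "m = 2 ^ k * u" "odd u" "u > 0"
    using power_part_decomposition[of 2 m] assms(2) by auto
  consider "k = 0" "\<not> 3 dvd m" | "k = 0" "9 dvd m" | "k > 0" "u = 1" | "k > 0" "u > 1"
    using ku(3) assms(3) by (cases "k = 0"; cases "u = 1") auto
  then show ?thesis
  proof cases
    case 1
    then have "odd m" using ku by simp
    then have "m = 1 \<or> m \<ge> 5"
      using 1(2) by (cases "m = 3"; cases "m = 2"; cases "m = 4") (auto elim!: oddE)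
    with 1 \<open>odd m\<close> show ?thesis using value_odd[OF assms(1)] by auto
  next
    case 2
    then obtain t where t: "m = 9 * t" by blast
    with 2 ku have "odd t" by auto
    then obtain j where "t = 2 * j + 1" by (elim oddE)
    with t show ?thesis using value_odd_9[OF assms(1), of j] by simp
  next
    case 3
    show ?thesis
    proof (cases "k \<le> 2")
      case True
      with 3 have "k = 1 \<or> k = 2" by auto
      with 3 ku show ?thesis using two small_values by auto
    next
      case False
      then have "k = k - 3 + 3" by simp
      then obtain l where l: "k = l + 3" by blast
      have "\<not> 3 dvd (2::nat) ^ (l + 1)" using prime_dvd_power[of "3::nat" 2 "l + 1"] by auto
      moreover have "m = 4 * 2 ^ (l + 1)" using 3 ku l by (simp add: power_add)
      moreover have "(2::nat) ^ (l + 1) \<ge> 2" by simp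
      ultimately show ?thesis using value_4[of "2 ^ (l + 1)"] assms(1) by metis
    qed
  next
    case 4
    have "2 ^ k < m" "u < m" using 4 ku one_less_power[of "2::nat" k] by auto
    have "\<not> 3 dvd (2::nat) ^ k" using prime_dvd_power[of "3::nat" 2 k] by auto
    then have "f (2 ^ k) = of_nat (2 ^ k)"
      using determined_belowD(2)[OF assms(1) _ \<open>2 ^ k < m\<close>] by simp
    moreover have "f u = of_nat u"
    proof (rule determined_belowD(2)[OF assms(1) ku(3) \<open>u < m\<close>])
      have "coprime (9::nat) (2 ^ k)" by simp
      then have "9 dvd m \<longleftrightarrow> 9 dvd u" unfolding ku(1) by (rule coprime_dvd_mult_right_iff)
      with assms(3) ku(1) show "\<not> (3 dvd u \<and> \<not> 9 dvd u)" by auto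
    qed
    ultimately show ?thesis using mult[of "2 ^ k" u] ku by simp
  qed
qed

text \<open>If 2 or 3 divides \<open>m\<close>, splitting off its full power leaves a smaller
  cofactor whose cube is already determined. Otherwise \<open>m\<close> is 1 or 5 modulo 6.\<close>

lemma cube_step:
  assumes "determined_below m" "m > 0"
  shows "f (m ^ 3) = of_nat (m ^ 3)"
proof -
  have prime_part: "f (m ^ 3) = of_nat (m ^ 3)"
    if "prime p" "p dvd m" "\<And>k. f ((p ^ k) ^ 3) = of_nat ((p ^ k) ^ 3)" for p
  proof -
    have "p > 1" using \<open>prime p\<close> by (rule prime_gt_1_nat)
    obtain k u where ku: "m = p ^ k * u" "\<not> p dvd u" "u > 0"
      using power_part_decomposition[OF \<open>p > 1\<close> assms(2)] .
    have "k \<noteq> 0" using ku that(2) by (cases k) auto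
    then have "u < m" using ku \<open>p > 1\<close> one_less_power[of p k] by simp
    have "coprime (p ^ k) u"
      using prime_imp_coprime[OF \<open>prime p\<close> ku(2)] by simp
    then show ?thesis
      using cube_mult[of "p ^ k" u] ku that(3)[of k] \<open>p > 1\<close>
        determined_belowD(1)[OF assms(1) ku(3) \<open>u < m\<close>]
      by (simp add: power_mult_distrib)
  qed
  consider "2 dvd m" | "3 dvd m" | "m mod 6 = 1" | "m mod 6 = 5"
  proof -
    have "2 dvd m \<or> 3 dvd m \<or> m mod 6 = 1 \<or> m mod 6 = 5" by presburger
    then show thesis using that by blast
  qed
  then show ?thesis
  proof cases
    case 1
    then show ?thesis using prime_part[of 2] cube_power_2 by simp
  next
    case 2
    then show ?thesis using prime_part[of 3] cube_power_3 by simp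
  next
    case 3
    then have "m = 6 * (m div 6) + 1" using div_mult_mod_eq[of m 6] by presburger
    then obtain j where j: "m = 6 * j + 1" by blast
    show ?thesis
    proof (cases j)
      case (Suc i)
      with j have "m = 6 * i + 7" by simp
      with assms(1) show ?thesis using cube_1_mod_6 by simp
    qed (use j in simp)
  next
    case 4
    then have "m = 6 * (m div 6) + 5" using div_mult_mod_eq[of m 6] by presburger
    then show ?thesis using cube_5_mod_6 assms(1) by metis
  qed
qed

lemma determined: "determined_below m"
proof (induction m)
  case (Suc m)
  then show ?case
    using value_step[OF Suc] cube_step[OF Suc]
    by (auto simp: determined_below_def less_Suc_eq)
qed (simp add: determined_below_def)

end

section \<open>Functions with an arbitrary value at 3\<close>

lemma sum_cubes_mod_9:
  fixes a b :: nat
  shows "\<not> (3 dvd a ^ 3 + b ^ 3 \<and> \<not> 9 dvd a ^ 3 + b ^ 3)"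
proof -
  have cube: "a ^ 3 mod 9 = 0 \<or> a ^ 3 mod 9 = 1 \<or> a ^ 3 mod 9 = 8" for a :: nat
  proof -
    have "a mod 9 < 9" by simp
    then have "a mod 9 \<in> {0,1,2,3,4,5,6,7,8}" by auto
    then have "(a mod 9) ^ 3 mod 9 \<in> {0,1,8}" by auto
    then show ?thesis by (simp add: power_mod)
  qed
  show ?thesis using cube[of a] cube[of b] by presburger
qed

lemma cube_mod_9: "\<not> (3 dvd (a::nat) ^ 3 \<and> \<not> 9 dvd a ^ 3)"
  using sum_cubes_mod_9[of a 0] by simp

text \<open>In a product of coprime numbers at most one factor contains 3 at all, so a weight placed
  on the exact divisors by 3 is multiplicative.\<close>

lemma exactly_3_mult:
  fixes m n :: nat
  assumes "coprime m n"
  shows "3 dvd m * n \<and> \<not> 9 dvd m * n \<longleftrightarrow>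
    (3 dvd m \<and> \<not> 9 dvd m) \<or> (3 dvd n \<and> \<not> 9 dvd n)"
    "\<not> (3 dvd m \<and> 3 dvd n)"
proof -
  show no: "\<not> (3 dvd m \<and> 3 dvd n)"
    using assms by (auto dest: coprime_common_divisor)
  have *: "9 dvd m * n \<longleftrightarrow> 9 dvd m" if "\<not> 3 dvd n" for m n :: nat
  proof -
    have "coprime 3 n" using that unfolding coprime_3_iff .
    then have "coprime (3 * 3) n" by (simp only: coprime_mult_left_iff)
    then show ?thesis using coprime_dvd_mult_left_iff[of 9 n m] by simp
  qed
  have "3 dvd m * n \<longleftrightarrow> 3 dvd m \<or> 3 dvd n"
    by (rule prime_dvd_mult_iff) simp
  moreover have "3 dvd k" if "9 dvd k" for k :: nat
    using that by presburger
  ultimately show "3 dvd m * n \<and> \<not> 9 dvd m * n \<longleftrightarrow>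
      (3 dvd m \<and> \<not> 9 dvd m) \<or> (3 dvd n \<and> \<not> 9 dvd n)"
    using no *[of n m] *[of m n] by (auto simp: mult.commute)
qed

lemma exists_arbitrary_value_at_3:
  "\<exists>f. multiplicative f \<and> f 3 = c \<and> additive_on_cubes f"
proof -
  \<comment> \<open>The identity is rescaled only where 3 divides \<open>n\<close> exactly once.
    Cubes and sums of two cubes avoid these \<open>n\<close>, so additivity is inherited from the
    identity.\<close>
  define f :: "nat \<Rightarrow> complex"
    where "f n = (if 3 dvd n \<and> \<not> 9 dvd n then c / 3 else 1) * of_nat n" for n
  have "multiplicative f"
    using exactly_3_mult by (auto simp: multiplicative_def f_def)
  moreover have "additive_on_cubes f"
    using sum_cubes_mod_9 cube_mod_9 by (auto simp: additive_on_cubes_def f_def)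
  moreover have "f 3 = c" by (simp add: f_def)
  ultimately show ?thesis by blast
qed

theorem theorem2p1:
  shows "(\<forall>f :: nat \<Rightarrow> complex. multiplicative f \<longrightarrow> additive_on_cubes f \<longrightarrow>
            (\<forall>n>0. \<not> (3 dvd n \<and> \<not> 3 ^ 2 dvd n) \<longrightarrow> f n = of_nat n)) \<and>
         (\<forall>c :: complex. \<exists>f :: nat \<Rightarrow> complex.
            multiplicative f \<and> f 3 = c \<and> additive_on_cubes f)"
proof (intro conjI allI impI)
  fix f :: "nat \<Rightarrow> complex" and n :: nat
  assume "multiplicative f" "additive_on_cubes f" and n: "n > 0" "\<not> (3 dvd n \<and> \<not> 3 ^ 2 dvd n)"
  then interpret cube_additive f by unfold_locales
  show "f n = of_nat n" using determined_belowD(2)[OF determined[of "Suc n"], of n] n by simp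
qed (rule exists_arbitrary_value_at_3)

end
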